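(* Let $\tilde{X}=\widehat{A}+\epsilon_2 \widehat{A}_0$ and $\tilde{Y}=\widehat{C}+\epsilon_2 \widehat{C}_0$ be $n\times n$ hyper-dual matrices such that the dual index of $\widehat{A}$ and of $\widehat{C}$ is 1. Suppose that the HDGGI of each of $\tilde{X}$, $\tilde{Y}$, $\tilde{X}\tilde{Y}$ exists, that $\widehat{A}\widehat{A}^{\#}\widehat{A}_0=\widehat{A}_0\widehat{A}\widehat{A}^{\#}=\widehat{A}_0$, and that $\widehat{C}\widehat{C}^{\#}\widehat{C}_0=\widehat{C}_0\widehat{C}\widehat{C}^{\#}=\widehat{C}_0$. If $\widehat{A}\widehat{C}=\widehat{C}\widehat{A}$, $\widehat{C}^{\#}\widehat{A}_0=\widehat{A}_0\widehat{C}^{\#}$ and $\widehat{A}^{\#}\widehat{C}_0=\widehat{C}_0\widehat{A}^{\#}$, then $$(\tilde{X}\tilde{Y})^{\#}=\tilde{X}^{\#}\tilde{Y}^{\#}=\tilde{Y}^{\#}\tilde{X}^{\#}.$$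
   Context: Hyper-dual numbers are elements $a_0+\epsilon_1a_1+\epsilon_2a_2+\epsilon_1\epsilon_2a_3$ with $a_i\in\mathbb{R}$, where $\epsilon_1,\epsilon_2$ commute, $\epsilon_1^2=\epsilon_2^2=0$ and $\epsilon_1\epsilon_2\ne0$ (i.e. the commutative ring $\mathbb{R}[\epsilon_1,\epsilon_2]/(\epsilon_1^2,\epsilon_2^2)$). A dual matrix is $\widehat{A}=A_0+\epsilon_1A_1$ with $A_0,A_1\in\mathbb{R}^{n\times n}$; a hyper-dual matrix is $\widehat A+\epsilon_2\widehat A_0$ with $\widehat A,\widehat A_0$ dual matrices. The group inverse of a square matrix $M$ (real, dual or hyper-dual) is the (unique, if it exists) matrix $G=M^{\#}$ of the same type with $MGM=M$, $GMG=G$, $MG=GM$. For hyper-dual matrices it is called the hyper-dual group generalized inverse (HDGGI). A dual matrix $\widehat A$ has dual index 1 if the range spaces of $\widehat A^2$ and $\widehat A$ (as maps on dual vectors) coincide; this is equivalent to the existence of $\widehat A^{\#}$. *)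

theory Defs
  imports "HOL-Analysis.Finite_Cartesian_Product"
begin

text \<open>\<open>Dual a b\<close> is \<open>a + \<epsilon>\<^sub>1 b\<close> with \<open>\<epsilon>\<^sub>1\<^sup>2 = 0\<close>.\<close>

datatype dual = Dual (dual_re: real) (dual_eps: real)

instantiation dual :: comm_ring_1
begin

definition "0 = Dual 0 0"
definition "1 = Dual 1 0"
definition "x + y = Dual (dual_re x + dual_re y) (dual_eps x + dual_eps y)"
definition "x - y = Dual (dual_re x - dual_re y) (dual_eps x - dual_eps y)"
definition "- x = Dual (- dual_re x) (- dual_eps x)"
definition "x * y = Dual (dual_re x * dual_re y) (dual_re x * dual_eps y + dual_eps x * dual_re y)"

instance
  by standard
    (auto simp: zero_dual_def one_dual_def plus_dual_def minus_dual_def uminus_dual_def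
      times_dual_def algebra_simps intro: dual.expand)

end

text \<open>\<open>HyperDual a b c d\<close> is \<open>a + \<epsilon>\<^sub>1 b + \<epsilon>\<^sub>2 c + \<epsilon>\<^sub>1 \<epsilon>\<^sub>2 d\<close>, an element of
  \<open>\<real>[\<epsilon>\<^sub>1, \<epsilon>\<^sub>2] / (\<epsilon>\<^sub>1\<^sup>2, \<epsilon>\<^sub>2\<^sup>2)\<close>.\<close>

datatype hyperdual = HyperDual (hd_re: real) (hd_eps1: real) (hd_eps2: real) (hd_eps12: real)

instantiation hyperdual :: comm_ring_1
begin

definition "0 = HyperDual 0 0 0 0"
definition "1 = HyperDual 1 0 0 0"
definition "x + y = HyperDual (hd_re x + hd_re y) (hd_eps1 x + hd_eps1 y)
  (hd_eps2 x + hd_eps2 y) (hd_eps12 x + hd_eps12 y)"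
definition "x - y = HyperDual (hd_re x - hd_re y) (hd_eps1 x - hd_eps1 y)
  (hd_eps2 x - hd_eps2 y) (hd_eps12 x - hd_eps12 y)"
definition "- x = HyperDual (- hd_re x) (- hd_eps1 x) (- hd_eps2 x) (- hd_eps12 x)"
definition "x * y = HyperDual
  (hd_re x * hd_re y)
  (hd_re x * hd_eps1 y + hd_eps1 x * hd_re y)
  (hd_re x * hd_eps2 y + hd_eps2 x * hd_re y)
  (hd_re x * hd_eps12 y + hd_eps1 x * hd_eps2 y + hd_eps2 x * hd_eps1 y + hd_eps12 x * hd_re y)"

instance
  by standard
    (auto simp: zero_hyperdual_def one_hyperdual_def plus_hyperdual_def minus_hyperdual_def
      uminus_hyperdual_def times_hyperdual_def algebra_simps intro: hyperdual.expand)

end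

definition eps1 :: hyperdual where "eps1 = HyperDual 0 1 0 0"
definition eps2 :: hyperdual where "eps2 = HyperDual 0 0 1 0"

definition hyperdual_of_real :: "real \<Rightarrow> hyperdual" where
  "hyperdual_of_real a = HyperDual a 0 0 0"

definition hyperdual_of_dual :: "dual \<Rightarrow> hyperdual" where
  "hyperdual_of_dual x = HyperDual (dual_re x) (dual_eps x) 0 0"

lemma eps_squares: "eps1 * eps1 = 0" "eps2 * eps2 = 0" "eps1 * eps2 \<noteq> 0"
  by (simp_all add: eps1_def eps2_def times_hyperdual_def zero_hyperdual_def)

lemma hyperdual_expansion:
  "HyperDual a b c d = hyperdual_of_real a + eps1 * hyperdual_of_real b
     + eps2 * hyperdual_of_real c + eps1 * eps2 * hyperdual_of_real d"
  by (simp add: eps1_def eps2_def hyperdual_of_real_def times_hyperdual_def plus_hyperdual_def)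

text \<open>Dual and hyper-dual square matrices are matrices with entries in \<^typ>\<open>dual\<close> and
  \<^typ>\<open>hyperdual\<close>; splitting each entry into its components gives the usual form
  \<open>A\<^sub>0 + \<epsilon>\<^sub>1 A\<^sub>1\<close> with real \<open>A\<^sub>0\<close>, \<open>A\<^sub>1\<close>. The following is \<open>A + \<epsilon>\<^sub>2 B\<close> for dual \<open>A\<close>, \<open>B\<close>.\<close>

definition hyperdual_matrix :: "dual ^ 'n ^ 'm \<Rightarrow> dual ^ 'n ^ 'm \<Rightarrow> hyperdual ^ 'n ^ 'm" where
  "hyperdual_matrix A B =
     (\<chi> i j. hyperdual_of_dual (A $ i $ j) + eps2 * hyperdual_of_dual (B $ i $ j))"

lemma hyperdual_matrix_unique_decomposition:
  fixes M :: "hyperdual ^ 'n ^ 'm"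
  shows "\<exists>!(A, B). M = hyperdual_matrix A B"
proof -
  define A where "A = (\<chi> i j. Dual (hd_re (M $ i $ j)) (hd_eps1 (M $ i $ j)))"
  define B where "B = (\<chi> i j. Dual (hd_eps2 (M $ i $ j)) (hd_eps12 (M $ i $ j)))"
  have "M = hyperdual_matrix A B"
    by (simp add: A_def B_def hyperdual_matrix_def vec_eq_iff hyperdual_of_dual_def eps2_def
        times_hyperdual_def plus_hyperdual_def)
  moreover have "A' = A \<and> B' = B" if "M = hyperdual_matrix A' B'" for A' B'
    by (simp add: that A_def B_def hyperdual_matrix_def vec_eq_iff hyperdual_of_dual_def eps2_def
        times_hyperdual_def plus_hyperdual_def)
  ultimately show ?thesis by auto
qed

definition is_group_inverse :: "'a::semiring_1 ^ 'n ^ 'n \<Rightarrow> 'a ^ 'n ^ 'n \<Rightarrow> bool" where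
  "is_group_inverse M G \<longleftrightarrow> M ** G ** M = M \<and> G ** M ** G = G \<and> M ** G = G ** M"

definition has_group_inverse :: "'a::semiring_1 ^ 'n ^ 'n \<Rightarrow> bool" where
  "has_group_inverse M \<longleftrightarrow> (\<exists>G. is_group_inverse M G)"

text \<open>Unspecified if no group inverse exists.\<close>

definition group_inverse :: "'a::semiring_1 ^ 'n ^ 'n \<Rightarrow> 'a ^ 'n ^ 'n" where
  "group_inverse M = (THE G. is_group_inverse M G)"

lemma is_group_inverse_unique:
  assumes "is_group_inverse M G" "is_group_inverse M H"
  shows "G = H"
proof -
  have G: "M ** G ** M = M" "G ** M ** G = G" "M ** G = G ** M"
    and H: "M ** H ** M = M" "H ** M ** H = H" "M ** H = H ** M"
    using assms by (auto simp: is_group_inverse_def)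
  have "M ** G = M ** H ** M ** G" by (simp only: H(1))
  also have "\<dots> = H ** (M ** (M ** G))" by (simp only: H(3) matrix_mul_assoc)
  also have "\<dots> = H ** M" by (simp only: G(3) matrix_mul_assoc) (metis G(1,3) matrix_mul_assoc)
  finally have MG: "M ** G = H ** M" .
  have "G = H ** M ** G" using G(2,3) MG by simp
  also have "\<dots> = H ** (H ** M)" by (metis MG matrix_mul_assoc)
  also have "\<dots> = H ** M ** H" by (metis H(3) matrix_mul_assoc)
  finally show ?thesis by (simp only: H(2))
qed

lemma is_group_inverse_group_inverse:
  "has_group_inverse M \<Longrightarrow> is_group_inverse M (group_inverse M)"
  unfolding has_group_inverse_def group_inverse_def
  by (metis is_group_inverse_unique the_equality)

text \<open>Ranges are taken over dual vectors; invertible matrices satisfy the condition as well.\<close>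

definition dual_index_one :: "dual ^ 'n ^ 'n \<Rightarrow> bool" where
  "dual_index_one A \<longleftrightarrow> range (\<lambda>x. (A ** A) *v x) = range (\<lambda>x. A *v x)"

end

theory Submission
  imports Defs
begin

text \<open>The group inverse of \<open>M\<close> lies in the double commutant of \<open>M\<close>, and conversely. Hence
  \<open>A\<^sub>0\<close> commutes with \<open>C\<close> and \<open>C\<^sub>0\<close> commutes with \<open>A\<close>, which makes \<open>X\<close> and \<open>Y\<close> commute: the product
  of the \<open>\<epsilon>\<^sub>2\<close>-parts \<open>A\<^sub>0\<close> and \<open>C\<^sub>0\<close> never appears, as \<open>\<epsilon>\<^sub>2\<^sup>2 = 0\<close>. For commuting \<open>X\<close> and \<open>Y\<close> the
  reverse order law holds in any ring.\<close>

lemma is_group_inverse_sym: "is_group_inverse M G \<Longrightarrow> is_group_inverse G M"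
  by (auto simp: is_group_inverse_def)

lemma group_inverse_eqI: "is_group_inverse M G \<Longrightarrow> group_inverse M = G"
  unfolding group_inverse_def by (blast intro: is_group_inverse_unique)

text \<open>Both products equal \<open>G ** M ** B ** G\<close>. From
  \<open>G = G ** G ** M = M ** G ** G\<close> and \<open>M = M ** M ** G = G ** M ** M\<close>, a
  factor \<open>M\<close> can be created next to \<open>B\<close>, carried across it by
  \<open>comm\<close>, and absorbed on the other side.\<close>

lemma is_group_inverse_commute:
  fixes M G B :: "'a::semiring_1 ^ 'n ^ 'n"
  assumes "is_group_inverse M G" and comm: "M ** B = B ** M"
  shows "G ** B = B ** G"
proof -
  have G: "M ** G ** M = M" "G ** M ** G = G" "M ** G = G ** M"
    using assms(1) by (auto simp: is_group_inverse_def)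
  have "G ** B = G ** G ** (M ** B)"
    by (metis G(2,3) matrix_mul_assoc)
  also have "\<dots> = G ** G ** B ** (M ** M ** G)"
    by (metis G(1,3) comm matrix_mul_assoc)
  also have "\<dots> = G ** G ** M ** M ** B ** G"
    by (metis comm matrix_mul_assoc)
  also have "\<dots> = G ** M ** B ** G"
    by (metis G(2,3) matrix_mul_assoc)
  finally have GB: "G ** B = G ** M ** B ** G" .
  have "B ** G = M ** B ** G ** G"
    by (metis G(2,3) comm matrix_mul_assoc)
  also have "\<dots> = G ** M ** M ** B ** G ** G"
    by (metis G(1,3))
  also have "\<dots> = G ** M ** B ** (M ** G ** G)"
    by (metis comm matrix_mul_assoc)
  also have "\<dots> = G ** M ** B ** G"
    by (metis G(2,3))
  finally show ?thesis using GB by simp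
qed

text \<open>Every matrix in the pair \<open>M\<close>, \<open>G\<close> commutes with every one in
  the pair \<open>N\<close>, \<open>H\<close>, by the previous lemma. So each defining equation for
  the product regroups into the one for \<open>M\<close>, \<open>G\<close> times the one for
  \<open>N\<close>, \<open>H\<close>.\<close>

lemma is_group_inverse_mult:
  fixes M N G H :: "'a::semiring_1 ^ 'n ^ 'n"
  assumes G: "is_group_inverse M G" and H: "is_group_inverse N H" and comm: "M ** N = N ** M"
  shows "is_group_inverse (M ** N) (G ** H)" and "G ** H = H ** G"
proof -
  have GN: "G ** N = N ** G"
    using is_group_inverse_commute[OF G comm] .
  have HM: "H ** M = M ** H"
    using is_group_inverse_commute[OF H comm[symmetric]] .
  show HG: "G ** H = H ** G"
    using is_group_inverse_commute[OF H GN[symmetric]] by simp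
  have MN: "M ** N ** (G ** H) = (M ** G) ** (N ** H)"
    by (metis GN matrix_mul_assoc)
  have NM: "G ** H ** (M ** N) = (G ** M) ** (H ** N)"
    by (metis HM matrix_mul_assoc)
  have "M ** N ** (G ** H) ** (M ** N) = (M ** G ** M) ** (N ** H ** N)"
    by (metis MN HM comm matrix_mul_assoc)
  then have "M ** N ** (G ** H) ** (M ** N) = M ** N"
    using G H by (metis is_group_inverse_def)
  moreover have "G ** H ** (M ** N) ** (G ** H) = (G ** M ** G) ** (H ** N ** H)"
    by (metis NM GN HG matrix_mul_assoc)
  then have "G ** H ** (M ** N) ** (G ** H) = G ** H"
    using G H by (metis is_group_inverse_def)
  moreover have "M ** N ** (G ** H) = G ** H ** (M ** N)"
    using G H MN NM by (metis is_group_inverse_def)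
  ultimately show "is_group_inverse (M ** N) (G ** H)"
    by (simp only: is_group_inverse_def)
qed

lemma hyperdual_of_dual_mult:
  "hyperdual_of_dual (x * y) = hyperdual_of_dual x * hyperdual_of_dual y"
  by (simp add: hyperdual_of_dual_def times_dual_def times_hyperdual_def)

lemma hyperdual_of_dual_add:
  "hyperdual_of_dual (x + y) = hyperdual_of_dual x + hyperdual_of_dual y"
  by (simp add: hyperdual_of_dual_def plus_dual_def plus_hyperdual_def)

lemma hyperdual_of_dual_sum:
  "hyperdual_of_dual (sum f S) = (\<Sum>i\<in>S. hyperdual_of_dual (f i))"
proof -
  have "hyperdual_of_dual 0 = 0"
    by (simp add: hyperdual_of_dual_def zero_dual_def zero_hyperdual_def)
  then show ?thesis
    by (induction S rule: infinite_finite_induct) (simp_all add: hyperdual_of_dual_add)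
qed

text \<open>With uniqueness of the decomposition, this turns an equation between hyper-dual products
  into a pair of equations between dual matrices.\<close>

lemma hyperdual_matrix_mult:
  fixes A B :: "dual ^ 'n ^ 'm" and C D :: "dual ^ 'p ^ 'n"
  shows "hyperdual_matrix A B ** hyperdual_matrix C D
    = hyperdual_matrix (A ** C) (A ** D + B ** C)"
proof -
  have "(a + eps2 * b) * (c + eps2 * d) = a * c + eps2 * (a * d + b * c)" for a b c d
  proof -
    have "(a + eps2 * b) * (c + eps2 * d)
        = a * c + eps2 * (a * d + b * c) + eps2 * eps2 * (b * d)"
      by (simp add: algebra_simps)
    then show ?thesis by (simp add: eps_squares)
  qed
  then show ?thesis
    by (simp add: hyperdual_matrix_def matrix_matrix_mult_def vec_eq_iff hyperdual_of_dual_sum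
        hyperdual_of_dual_add hyperdual_of_dual_mult sum.distrib sum_distrib_left distrib_left)
qed

lemma hyperdual_matrix_eq_iff:
  "hyperdual_matrix A B = hyperdual_matrix C D \<longleftrightarrow> A = C \<and> B = D"
  using hyperdual_matrix_unique_decomposition[of "hyperdual_matrix A B"] by auto

text \<open>Dropping the \<epsilon>2-part respects products, so the dual part of a group inverse of
  \<open>hyperdual_matrix A B\<close> is a group inverse of \<open>A\<close>. This ensures that
  \<open>group_inverse A\<close> is not an unspecified value.\<close>

lemma has_group_inverse_dual_part:
  assumes "has_group_inverse (hyperdual_matrix A B)"
  shows "has_group_inverse A"
proof -
  obtain G where G: "is_group_inverse (hyperdual_matrix A B) G"
    using assms by (auto simp: has_group_inverse_def)
  obtain H K where "G = hyperdual_matrix H K"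
    using hyperdual_matrix_unique_decomposition[of G] by auto
  with G have "is_group_inverse A H"
    by (auto simp: is_group_inverse_def hyperdual_matrix_mult hyperdual_matrix_eq_iff)
  then show ?thesis
    by (auto simp: has_group_inverse_def)
qed

theorem theorem5p1:
  fixes A A0 C C0 :: "dual ^ 'n ^ 'n"
    and X Y :: "hyperdual ^ 'n ^ 'n"
  assumes "X = hyperdual_matrix A A0"
    and "Y = hyperdual_matrix C C0"
    and "dual_index_one A"
    and "dual_index_one C"
    and "has_group_inverse X"
    and "has_group_inverse Y"
    and "has_group_inverse (X ** Y)"
    and "A ** group_inverse A ** A0 = A0"
    and "A0 ** A ** group_inverse A = A0"
    and "C ** group_inverse C ** C0 = C0"
    and "C0 ** C ** group_inverse C = C0"
    and "A ** C = C ** A"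
    and "group_inverse C ** A0 = A0 ** group_inverse C"
    and "group_inverse A ** C0 = C0 ** group_inverse A"
  shows "group_inverse (X ** Y) = group_inverse X ** group_inverse Y
    \<and> group_inverse X ** group_inverse Y = group_inverse Y ** group_inverse X"
proof -
  have A: "is_group_inverse A (group_inverse A)" and C: "is_group_inverse C (group_inverse C)"
    using assms(1,2,5,6)
    by (auto intro: is_group_inverse_group_inverse has_group_inverse_dual_part)
  \<comment> \<open>\<open>C\<close> is itself the group inverse of \<open>group_inverse C\<close>,
    so whatever commutes with the latter commutes with \<open>C\<close>.\<close>
  have "C ** A0 = A0 ** C"
    using is_group_inverse_commute[OF is_group_inverse_sym[OF C]] assms(13) .
  moreover have "A ** C0 = C0 ** A"
    using is_group_inverse_commute[OF is_group_inverse_sym[OF A]] assms(14) .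
  \<comment> \<open>The \<epsilon>2-parts are \<open>A ** C0 + A0 ** C\<close> and
    \<open>C ** A0 + C0 ** A\<close>, which now agree up to the order of summands.\<close>
  ultimately have "X ** Y = Y ** X"
    by (simp add: assms(1,2,12) hyperdual_matrix_mult add.commute)
  with assms(5,6) show ?thesis
    by (metis is_group_inverse_mult group_inverse_eqI is_group_inverse_group_inverse)
qed

end
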